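(* Let $k$ be a field of characteristic different from $2$ and let $q \in k\setminus\{0\}$. Let $F = ax^2 + bxy + cy^2 + f$ be a quadratic form in the quantum plane $\mathcal{O}_q(k^2)$ (so $a,b,c,f \in k$ with at least one of $a,b,c$ nonzero), and let $\Delta_q F = b^2 - 4acq$. Then $F$ is reducible in $\mathcal{O}_q(k^2)$ if and only if one of the following holds. 1. $f = 0$ and $\Delta_q F$ is a square in $k$. 2. $f \neq 0$, there exists $\delta \in k$ such that $\Delta_q F = \delta^2$ and $\delta(1+q) = b(q-1)$, and either (a) $a \neq 0$ and $-af$ is a square in $k$, or (b) $c \neq 0$ and $-cf$ is a square in $k$.
   Context: The quantum plane is $\mathcal{O}_q(k^2) = k[x][y;\sigma]$, where $\sigma$ is the $k$-algebra automorphism of $k[x]$ with $\sigma(x) = qx$; that is, the $k$-algebra generated by $x,y$ subject to $yx = qxy$. It is a domain with $k$-basis $\{x^iy^j\}$. A quadratic form is an element $ax^2 + bxy + cy^2 + dx + ey + f$ with $a,b,c,d,e,f \in k$ and at least one of $a,b,c$ nonzero; its quantum discriminant is $\Delta_q(F) = b^2 - 4acq$. An element of a domain is irreducible if it is not a unit and whenever it is written as a product $gh$, either $g$ or $h$ is a unit; a nonzero nonunit that is not irreducible is reducible. *)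

theory Defs
  imports
    "HOL-Algebra.Ring"
    "HOL-Computational_Algebra.Polynomial"
    "HOL-Computational_Algebra.Formal_Power_Series"
    "HOL-Computational_Algebra.Nth_Powers"
begin

text \<open>
  For a ring endomorphism \<open>\<sigma>\<close> of \<open>'a\<close>, the ring \<open>'a[y; \<sigma>]\<close> has the elements
  \<open>\<Sum>\<^sub>j r\<^sub>j y\<^sup>j\<close>, coefficients written on the left and stored as an ordinary polynomial in \<open>y\<close>;
  the product is determined by \<open>y r = \<sigma>(r) y\<close>, that is, by
  \<open>(r y\<^sup>i) (s y\<^sup>j) = r \<sigma>\<^sup>i(s) y\<^sup>i\<^sup>+\<^sup>j\<close>.
\<close>

definition skew_mult :: "('a::comm_ring_1 \<Rightarrow> 'a) \<Rightarrow> 'a poly \<Rightarrow> 'a poly \<Rightarrow> 'a poly" where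
  "skew_mult \<sigma> F G =
     (\<Sum>i\<le>degree F. \<Sum>j\<le>degree G. monom (coeff F i * (\<sigma> ^^ i) (coeff G j)) (i + j))"

definition skew_poly_ring :: "('a::comm_ring_1 \<Rightarrow> 'a) \<Rightarrow> 'a poly ring" where
  "skew_poly_ring \<sigma> =
     \<lparr>carrier = UNIV, monoid.mult = skew_mult \<sigma>, one = 1, zero = 0, add = (+)\<rparr>"

text \<open>Elements of \<open>k[x][y; \<sigma>]\<close>: the outer polynomial variable is \<open>y\<close>, the inner one is \<open>x\<close>.
  The endomorphism \<open>x \<mapsto> q x\<close> of \<open>k[x]\<close> (an automorphism for \<open>q \<noteq> 0\<close>) is substitution of \<open>q x\<close> for \<open>x\<close>.\<close>

definition quantum_plane :: "'k::field \<Rightarrow> 'k poly poly ring" where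
  "quantum_plane q = skew_poly_ring (\<lambda>p. p \<circ>\<^sub>p [:0, q:])"

definition qp_const :: "'k::field \<Rightarrow> 'k poly poly" where
  "qp_const a = [:[:a:]:]"

definition qp_x :: "'k::field poly poly" where
  "qp_x = [:[:0, 1:]:]"

definition qp_y :: "'k::field poly poly" where
  "qp_y = [:0, 1:]"

definition quad_form :: "'k::field \<Rightarrow> 'k \<Rightarrow> 'k \<Rightarrow> 'k \<Rightarrow> 'k \<Rightarrow> 'k \<Rightarrow> 'k \<Rightarrow> 'k poly poly" where
  "quad_form q a b c d e f =
     (qp_const a \<otimes>\<^bsub>quantum_plane q\<^esub> (qp_x [^]\<^bsub>quantum_plane q\<^esub> (2::nat)))
     \<oplus>\<^bsub>quantum_plane q\<^esub> (qp_const b \<otimes>\<^bsub>quantum_plane q\<^esub> (qp_x \<otimes>\<^bsub>quantum_plane q\<^esub> qp_y))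
     \<oplus>\<^bsub>quantum_plane q\<^esub> (qp_const c \<otimes>\<^bsub>quantum_plane q\<^esub> (qp_y [^]\<^bsub>quantum_plane q\<^esub> (2::nat)))
     \<oplus>\<^bsub>quantum_plane q\<^esub> (qp_const d \<otimes>\<^bsub>quantum_plane q\<^esub> qp_x)
     \<oplus>\<^bsub>quantum_plane q\<^esub> (qp_const e \<otimes>\<^bsub>quantum_plane q\<^esub> qp_y)
     \<oplus>\<^bsub>quantum_plane q\<^esub> qp_const f"

definition quantum_disc :: "'k::field \<Rightarrow> 'k \<Rightarrow> 'k \<Rightarrow> 'k \<Rightarrow> 'k" where
  "quantum_disc q a b c = b\<^sup>2 - 4 * a * c * q"

text \<open>
  The notion \<open>irreducible\<close> of HOL-Algebra is phrased through one-sided divisibility and is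
  intended for commutative monoids, so the product formulation is stated here.
\<close>

definition nc_irreducible :: "('a, 'm) ring_scheme \<Rightarrow> 'a \<Rightarrow> bool" where
  "nc_irreducible R p \<longleftrightarrow> p \<in> carrier R \<and> p \<notin> Units R \<and>
     (\<forall>g\<in>carrier R. \<forall>h\<in>carrier R. p = g \<otimes>\<^bsub>R\<^esub> h \<longrightarrow> g \<in> Units R \<or> h \<in> Units R)"

definition nc_reducible :: "('a, 'm) ring_scheme \<Rightarrow> 'a \<Rightarrow> bool" where
  "nc_reducible R p \<longleftrightarrow> p \<in> carrier R \<and> p \<noteq> \<zero>\<^bsub>R\<^esub> \<and> p \<notin> Units R \<and> \<not> nc_irreducible R p"

locale ring_endo =
  fixes \<sigma> :: "'a::comm_ring_1 \<Rightarrow> 'a"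
  assumes endo_add: "\<sigma> (r + s) = \<sigma> r + \<sigma> s"
    and endo_mult: "\<sigma> (r * s) = \<sigma> r * \<sigma> s"
    and endo_one: "\<sigma> 1 = 1"
begin

lemma endo_zero: "\<sigma> 0 = 0"
  using endo_add[of 0 0] by simp

lemma funpow_simps:
  "(\<sigma> ^^ n) 0 = 0" "(\<sigma> ^^ n) 1 = 1"
  "(\<sigma> ^^ n) (r + s) = (\<sigma> ^^ n) r + (\<sigma> ^^ n) s"
  "(\<sigma> ^^ n) (r * s) = (\<sigma> ^^ n) r * (\<sigma> ^^ n) s"
  by (induction n) (simp_all add: endo_zero endo_one endo_add endo_mult)

lemma funpow_sum: "(\<sigma> ^^ n) (\<Sum>i\<in>A. f i) = (\<Sum>i\<in>A. (\<sigma> ^^ n) (f i))"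
  by (induction A rule: infinite_finite_induct) (simp_all add: funpow_simps)

lemma coeff_skew_mult:
  "coeff (skew_mult \<sigma> F G) n = (\<Sum>i=0..n. coeff F i * (\<sigma> ^^ i) (coeff G (n - i)))"
proof -
  let ?t = "\<lambda>i j. coeff F i * (\<sigma> ^^ i) (coeff G j)"
  have inner: "(\<Sum>j\<le>degree G. if i + j = n then ?t i j else 0) =
      (if i \<le> n then ?t i (n - i) else 0)" for i
  proof (cases "i \<le> n")
    case True
    then have eq: "i + j = n \<longleftrightarrow> j = n - i" for j by auto
    show ?thesis
      using True by (auto simp: eq coeff_eq_0 funpow_simps)
  qed auto
  have "coeff (skew_mult \<sigma> F G) n =
      (\<Sum>i\<le>degree F. \<Sum>j\<le>degree G. if i + j = n then ?t i j else 0)"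
    by (simp add: skew_mult_def coeff_sum)
  also have "\<dots> = (\<Sum>i\<le>degree F. if i \<le> n then ?t i (n - i) else 0)"
    by (simp add: inner)
  also have "\<dots> = (\<Sum>i\<in>{..degree F} \<inter> {0..n}. ?t i (n - i))"
    by (subst sum.inter_restrict) (simp_all cong: if_cong)
  also have "\<dots> = (\<Sum>i=0..n. ?t i (n - i))"
    by (rule sum.mono_neutral_left) (auto simp: coeff_eq_0)
  finally show ?thesis .
qed

lemma skew_mult_assoc:
  "skew_mult \<sigma> (skew_mult \<sigma> F G) H = skew_mult \<sigma> F (skew_mult \<sigma> G H)"
proof (rule poly_eqI)
  fix n
  let ?t = "\<lambda>i j k. coeff F i * (\<sigma> ^^ i) (coeff G j) * (\<sigma> ^^ (i + j)) (coeff H k)"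
  have "coeff (skew_mult \<sigma> (skew_mult \<sigma> F G) H) n =
      (\<Sum>j=0..n. \<Sum>i=0..j. ?t i (j - i) (n - j))"
    by (simp add: coeff_skew_mult sum_distrib_right)
  also have "\<dots> = (\<Sum>j=0..n. \<Sum>i=0..n - j. ?t j i (n - j - i))"
    by (rule fps_mult_assoc_lemma)
  also have "\<dots> = coeff (skew_mult \<sigma> F (skew_mult \<sigma> G H)) n"
    by (simp add: coeff_skew_mult sum_distrib_left funpow_sum funpow_simps funpow_add mult.assoc)
  finally show "coeff (skew_mult \<sigma> (skew_mult \<sigma> F G) H) n =
      coeff (skew_mult \<sigma> F (skew_mult \<sigma> G H)) n" .
qed

lemma skew_mult_add_left: "skew_mult \<sigma> (F + G) H = skew_mult \<sigma> F H + skew_mult \<sigma> G H"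
  by (rule poly_eqI) (simp add: coeff_skew_mult distrib_right sum.distrib)

lemma skew_mult_add_right: "skew_mult \<sigma> F (G + H) = skew_mult \<sigma> F G + skew_mult \<sigma> F H"
  by (rule poly_eqI) (simp add: coeff_skew_mult funpow_simps distrib_left sum.distrib)

lemma skew_mult_const: "skew_mult \<sigma> [:r:] F = smult r F"
proof (rule poly_eqI)
  fix n
  have "coeff (skew_mult \<sigma> [:r:] F) n = (\<Sum>i=0..n. if i = 0 then r * coeff F n else 0)"
    unfolding coeff_skew_mult by (rule sum.cong) (auto simp: coeff_pCons split: nat.splits)
  then show "coeff (skew_mult \<sigma> [:r:] F) n = coeff (smult r F) n" by simp
qed

lemma skew_mult_one_left: "skew_mult \<sigma> 1 F = F"
  using skew_mult_const[of 1 F] by (simp flip: one_pCons)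

lemma skew_mult_one_right: "skew_mult \<sigma> F 1 = F"
proof (rule poly_eqI)
  fix n
  have "coeff (skew_mult \<sigma> F 1) n = (\<Sum>i=0..n. if i = n then coeff F n else 0)"
    unfolding coeff_skew_mult by (rule sum.cong) (auto simp: coeff_1 funpow_simps)
  then show "coeff (skew_mult \<sigma> F 1) n = coeff F n" by simp
qed

lemma ring_skew_poly_ring: "ring (skew_poly_ring \<sigma>)"
proof (rule ringI)
  show "abelian_group (skew_poly_ring \<sigma>)"
  proof (rule abelian_groupI)
    fix F assume "F \<in> carrier (skew_poly_ring \<sigma>)"
    show "\<exists>G\<in>carrier (skew_poly_ring \<sigma>). G \<oplus>\<^bsub>skew_poly_ring \<sigma>\<^esub> F = \<zero>\<^bsub>skew_poly_ring \<sigma>\<^esub>"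
      by (rule bexI[of _ "- F"]) (simp_all add: skew_poly_ring_def)
  qed (simp_all add: skew_poly_ring_def ac_simps)
  show "monoid (skew_poly_ring \<sigma>)"
    by (rule monoidI)
      (simp_all add: skew_poly_ring_def skew_mult_assoc skew_mult_one_left skew_mult_one_right)
qed (simp_all add: skew_poly_ring_def skew_mult_add_left skew_mult_add_right)

lemma skew_mult_nonzero:
  assumes inj: "\<And>r. \<sigma> r = 0 \<Longrightarrow> r = 0"
    and dom: "\<And>r s :: 'a. r * s = 0 \<Longrightarrow> r = 0 \<or> s = 0"
    and "F \<noteq> 0" "G \<noteq> 0"
  shows "skew_mult \<sigma> F G \<noteq> 0"
proof -
  have inj': "(\<sigma> ^^ n) r = 0 \<Longrightarrow> r = 0" for n r
    by (induction n) (auto dest: inj)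
  have "coeff (skew_mult \<sigma> F G) (degree F + degree G) =
      (\<Sum>i=0..degree F + degree G. if i = degree F
         then lead_coeff F * (\<sigma> ^^ degree F) (lead_coeff G) else 0)"
    unfolding coeff_skew_mult
  proof (rule sum.cong)
    fix i
    show "coeff F i * (\<sigma> ^^ i) (coeff G (degree F + degree G - i)) = (if i = degree F
         then lead_coeff F * (\<sigma> ^^ degree F) (lead_coeff G) else 0)"
      by (cases i "degree F" rule: linorder_cases) (auto simp: coeff_eq_0 funpow_simps)
  qed simp
  also have "\<dots> = lead_coeff F * (\<sigma> ^^ degree F) (lead_coeff G)" by simp
  also have "\<dots> \<noteq> 0"
    using dom inj' assms(3,4) leading_coeff_0_iff by metis
  finally show ?thesis by auto
qed

end

lemma ring_endo_scale: "ring_endo (\<lambda>p. p \<circ>\<^sub>p [:0, q::'k::field:])"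
  by unfold_locales (simp_all add: pcompose_add pcompose_mult pcompose_1)

lemma ring_quantum_plane: "ring (quantum_plane q)"
  unfolding quantum_plane_def by (rule ring_endo.ring_skew_poly_ring[OF ring_endo_scale])

lemma quantum_plane_no_zero_divisors:
  assumes "q \<noteq> 0" "F \<noteq> \<zero>\<^bsub>quantum_plane q\<^esub>" "G \<noteq> \<zero>\<^bsub>quantum_plane q\<^esub>"
  shows "F \<otimes>\<^bsub>quantum_plane q\<^esub> G \<noteq> \<zero>\<^bsub>quantum_plane q\<^esub>"
  using assms ring_endo.skew_mult_nonzero[OF ring_endo_scale, of q F G]
  by (auto simp: quantum_plane_def skew_poly_ring_def pcompose_eq_0_iff)

lemma qp_const_mult: "qp_const a \<otimes>\<^bsub>quantum_plane q\<^esub> F = smult [:a:] F"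
  by (simp add: quantum_plane_def skew_poly_ring_def qp_const_def
      ring_endo.skew_mult_const[OF ring_endo_scale])

lemma qp_const_central:
  "F \<otimes>\<^bsub>quantum_plane q\<^esub> qp_const a = qp_const a \<otimes>\<^bsub>quantum_plane q\<^esub> F"
proof -
  have pow: "((\<lambda>p. p \<circ>\<^sub>p [:0, q:]) ^^ n) [:a:] = [:a:]" for n
    by (induction n) simp_all
  interpret ring_endo "\<lambda>p. p \<circ>\<^sub>p [:0, q:]" by (rule ring_endo_scale)
  have "coeff (skew_mult (\<lambda>p. p \<circ>\<^sub>p [:0, q:]) F [:[:a:]:]) n = coeff (smult [:a:] F) n" for n
  proof -
    have "coeff (skew_mult (\<lambda>p. p \<circ>\<^sub>p [:0, q:]) F [:[:a:]:]) n =
        (\<Sum>i=0..n. if i = n then [:a:] * coeff F n else 0)"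
      unfolding coeff_skew_mult
      by (rule sum.cong) (auto simp: coeff_pCons pow funpow_simps split: nat.splits)
    then show ?thesis by simp
  qed
  then show ?thesis
    unfolding qp_const_mult
    by (simp add: quantum_plane_def skew_poly_ring_def qp_const_def poly_eq_iff)
qed

lemma qp_y_times_x:
  "qp_y \<otimes>\<^bsub>quantum_plane q\<^esub> qp_x =
   qp_const q \<otimes>\<^bsub>quantum_plane q\<^esub> (qp_x \<otimes>\<^bsub>quantum_plane q\<^esub> qp_y)"
  by (simp add: qp_const_mult)
    (simp add: quantum_plane_def skew_poly_ring_def skew_mult_def qp_x_def qp_y_def
      monom_altdef pcompose_pCons smult_monom)

lemma quad_form_eq:
  "quad_form q a b c d e f = [:[:f, d, a:], [:e, b:], [:c:]:]"
  by (simp add: quad_form_def qp_const_mult)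
    (simp add: quantum_plane_def skew_poly_ring_def skew_mult_def qp_const_def qp_x_def qp_y_def
      numeral_2_eq_2 nat_pow_def monom_Suc monom_0 one_pCons)

end

theory Submission
  imports Defs
begin

text \<open>
  The leading monomial for the order by total degree, ties broken by the \<open>y\<close>-degree, is
  multiplicative up to a power of \<open>q\<close>. Hence the units are the nonzero constants, and a proper
  factorization of a quadratic form has two factors \<open>\<alpha>x + \<beta>y + \<gamma>\<close> and \<open>\<alpha>'x + \<beta>'y + \<gamma>'\<close>.
  Put \<open>s = \<alpha>\<beta>'\<close> and \<open>t = \<beta>\<alpha>'\<close>: then \<open>s + qt = b\<close> and \<open>st = ac\<close>, so the discriminant
  is \<open>(s - qt)\<^sup>2\<close>. If \<open>f = 0\<close> both constant terms vanish and this is the only condition. If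
  \<open>f \<noteq> 0\<close>, the absence of linear terms forces the second factor to be
  \<open>\<lambda>(\<alpha>x + \<beta>y - \<gamma>)\<close>, so that \<open>a = \<lambda>\<alpha>\<^sup>2\<close>, \<open>c = \<lambda>\<beta>\<^sup>2\<close>, \<open>b = \<lambda>\<alpha>\<beta>(1 + q)\<close>
  and \<open>f = -\<lambda>\<gamma>\<^sup>2\<close>.
\<close>

section \<open>Coefficients of products and leading monomials\<close>

lemma coeff_funpow_scale:
  "coeff (((\<lambda>p. p \<circ>\<^sub>p [:0, q:]) ^^ i) p) m = q ^ (i * m) * coeff p m"
  for q :: "'k::field"
  by (induction i) (simp_all add: coeff_pcompose_linear power_add mult.assoc)

text \<open>Moving \<open>y^i\<close> past \<open>x^(m - k)\<close> produces the factor
  \<open>q ^ (i * (m - k))\<close> in each term of the usual convolution.\<close>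

lemma coeff_quantum_plane_mult:
  "coeff (coeff (g \<otimes>\<^bsub>quantum_plane q\<^esub> h) n) m =
     (\<Sum>i\<le>n. \<Sum>k\<le>m. coeff (coeff g i) k * (q ^ (i * (m - k)) * coeff (coeff h (n - i)) (m - k)))"
  by (simp add: quantum_plane_def skew_poly_ring_def
      ring_endo.coeff_skew_mult[OF ring_endo_scale] coeff_sum coeff_mult coeff_funpow_scale
      atMost_atLeast0)

text \<open>\<open>m\<close> is the exponent of \<open>x\<close> and \<open>n\<close> that of
  \<open>y\<close>, although \<open>coeff\<close> reads off the outer variable \<open>y\<close>
  first.\<close>

definition leading_at :: "'k::field poly poly \<Rightarrow> nat \<Rightarrow> nat \<Rightarrow> bool" where
  "leading_at g m n \<longleftrightarrow> coeff (coeff g n) m \<noteq> 0 \<and>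
     (\<forall>k i. m + n < k + i \<or> (m + n = k + i \<and> n < i) \<longrightarrow> coeff (coeff g i) k = 0)"

lemma leading_at_exists:
  assumes "g \<noteq> 0"
  obtains m n where "leading_at g m n"
proof -
  \<comment> \<open>A crude bound on the total degrees of the monomials of \<open>g\<close>; adding
    up all the inner degrees avoids a maximum. \<open>Greatest\<close> on \<open>nat\<close> needs
    such a bound.\<close>
  let ?B = "degree g + (\<Sum>i\<le>degree g. degree (coeff g i))"
  have bound: "k + i \<le> ?B" if "coeff (coeff g i) k \<noteq> 0" for k i
  proof -
    have i: "i \<le> degree g" using that by (metis coeff_0 coeff_eq_0 not_le)
    have "k \<le> degree (coeff g i)" using that by (rule le_degree)
    also have "\<dots> \<le> (\<Sum>i\<le>degree g. degree (coeff g i))"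
      using i by (intro member_le_sum) auto
    finally show ?thesis using i by simp
  qed
  let ?P = "\<lambda>d. \<exists>k i. k + i = d \<and> coeff (coeff g i) k \<noteq> 0"
  from assms have "\<exists>d. ?P d" by (metis coeff_0 poly_eqI)
  moreover have le: "\<And>d. ?P d \<Longrightarrow> d \<le> ?B" using bound by blast
  ultimately have "?P (Greatest ?P)" by (rule GreatestI_ex_nat)
  then obtain d where d: "?P d" "\<And>e. ?P e \<Longrightarrow> e \<le> d"
    using Greatest_le_nat[where P = ?P, OF _ le] by blast
  let ?Q = "\<lambda>i. i \<le> d \<and> coeff (coeff g i) (d - i) \<noteq> 0"
  from d(1) have "\<exists>i. ?Q i" by (metis add_diff_cancel_right' le_add2)
  then have "?Q (Greatest ?Q)" by (rule GreatestI_ex_nat[where b = d]) simp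
  then obtain n where n: "?Q n" "\<And>i. ?Q i \<Longrightarrow> i \<le> n"
    using Greatest_le_nat[where P = ?Q and b = d] by blast
  have "leading_at g (d - n) n"
    unfolding leading_at_def
  proof (intro conjI allI impI)
    show "coeff (coeff g n) (d - n) \<noteq> 0" using n by simp
    fix k i assume A: "d - n + n < k + i \<or> (d - n + n = k + i \<and> n < i)"
    show "coeff (coeff g i) k = 0"
    proof (rule ccontr)
      assume nz: "coeff (coeff g i) k \<noteq> 0"
      then have "k + i \<le> d" using d(2) by blast
      with A n(1) have "d = k + i" "n < i" by auto
      with n(2)[of i] nz show False by simp
    qed
  qed
  then show thesis by (rule that)
qed

text \<open>In the convolution for this coefficient, the two monomials of a term have exponents
  adding up to those of the leading pair. If they are not the leading pair, one of them lies above
  the leading monomial of its factor, so the term vanishes. The single surviving term carries a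
  power of \<open>q\<close>, which is nonzero.\<close>

lemma leading_at_mult_nonzero:
  assumes q: "q \<noteq> 0" and g: "leading_at g m n" and h: "leading_at h m' n'"
  shows "coeff (coeff (g \<otimes>\<^bsub>quantum_plane q\<^esub> h) (n + n')) (m + m') \<noteq> 0"
proof -
  let ?t = "\<lambda>i k. coeff (coeff g i) k *
    (q ^ (i * (m + m' - k)) * coeff (coeff h (n + n' - i)) (m + m' - k))"
  have z: "?t i k = 0" if ik: "i \<le> n + n'" "k \<le> m + m'" "i \<noteq> n \<or> k \<noteq> m" for i k
  proof -
    consider "m + n < k + i \<or> (m + n = k + i \<and> n < i)"
      | "m' + n' < (m + m' - k) + (n + n' - i) \<or>
         (m' + n' = (m + m' - k) + (n + n' - i) \<and> n' < n + n' - i)"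
      using ik(3) le_add_diff_inverse[OF ik(1)] le_add_diff_inverse[OF ik(2)] by linarith
    then show ?thesis
    proof cases
      case 1
      then have "coeff (coeff g i) k = 0" using g unfolding leading_at_def by blast
      then show ?thesis by simp
    next
      case 2
      then have "coeff (coeff h (n + n' - i)) (m + m' - k) = 0"
        using h unfolding leading_at_def by blast
      then show ?thesis by simp
    qed
  qed
  have inner: "(\<Sum>k\<le>m + m'. ?t i k) = (if i = n then ?t n m else 0)" if "i \<le> n + n'" for i
  proof -
    have "(\<Sum>k\<le>m + m'. ?t i k) = (\<Sum>k\<le>m + m'. if k = m then (if i = n then ?t n m else 0) else 0)"
    proof (rule sum.cong)
      fix k assume k: "k \<in> {..m + m'}"
      show "?t i k = (if k = m then (if i = n then ?t n m else 0) else 0)"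
      proof (cases "i = n \<and> k = m")
        case False
        then have "?t i k = 0" using z[OF that, of k] k by blast
        then show ?thesis using False by presburger
      qed simp
    qed simp
    then show ?thesis by simp
  qed
  have "coeff (coeff (g \<otimes>\<^bsub>quantum_plane q\<^esub> h) (n + n')) (m + m') =
      (\<Sum>i\<le>n + n'. if i = n then ?t n m else 0)"
    unfolding coeff_quantum_plane_mult by (intro sum.cong refl inner) simp
  also have "\<dots> = ?t n m" by simp
  also have "\<dots> \<noteq> 0" using q g h by (simp add: leading_at_def)
  finally show ?thesis .
qed

lemma leading_at_0_0:
  assumes "leading_at g 0 0"
  shows "\<exists>u. u \<noteq> 0 \<and> g = qp_const u"
proof -
  have "coeff (coeff g i) k = coeff (coeff (qp_const (coeff (coeff g 0) 0)) i) k" for i k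
    using assms by (auto simp: leading_at_def qp_const_def coeff_pCons split: nat.splits)
  then have "g = qp_const (coeff (coeff g 0) 0)" by (intro poly_eqI)
  with assms show ?thesis by (auto simp: leading_at_def)
qed

section \<open>Units of the quantum plane\<close>

lemma quantum_plane_simps:
  "carrier (quantum_plane q) = UNIV" "\<one>\<^bsub>quantum_plane q\<^esub> = 1" "\<zero>\<^bsub>quantum_plane q\<^esub> = 0"
  by (simp_all add: quantum_plane_def skew_poly_ring_def)

text \<open>The product of the leading monomials of a unit and its inverse has to occur in
  \<open>1\<close>, so all exponents are zero.\<close>

lemma Units_quantum_plane:
  fixes q :: "'k::field"
  assumes "q \<noteq> 0"
  shows "g \<in> Units (quantum_plane q) \<longleftrightarrow> (\<exists>u. u \<noteq> 0 \<and> g = qp_const u)"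
proof
  assume "g \<in> Units (quantum_plane q)"
  then obtain h where gh: "g \<otimes>\<^bsub>quantum_plane q\<^esub> h = 1"
    by (auto simp: Units_def quantum_plane_simps)
  interpret ring "quantum_plane q" by (rule ring_quantum_plane)
  have "g \<noteq> 0" "h \<noteq> 0"
    using gh l_null[of h] r_null[of g] by (auto simp: quantum_plane_simps)
  then obtain m n m' n' where g: "leading_at g m n" and h: "leading_at h m' n'"
    by (metis leading_at_exists)
  have "coeff (coeff 1 (n + n')) (m + m') \<noteq> (0::'k)"
    using leading_at_mult_nonzero[OF assms g h] gh by simp
  then have "m = 0" "n = 0" by (auto simp: coeff_1 of_bool_def split: if_splits)
  then show "\<exists>u. u \<noteq> 0 \<and> g = qp_const u" using g leading_at_0_0 by blast
next
  assume "\<exists>u. u \<noteq> 0 \<and> g = qp_const u"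
  then obtain u where u: "u \<noteq> 0" "g = qp_const u" by blast
  have "qp_const (inverse u) \<otimes>\<^bsub>quantum_plane q\<^esub> qp_const u = 1"
    "qp_const u \<otimes>\<^bsub>quantum_plane q\<^esub> qp_const (inverse u) = 1"
    unfolding qp_const_mult using u by (simp_all add: qp_const_def one_pCons)
  then show "g \<in> Units (quantum_plane q)"
    using u by (auto simp: Units_def quantum_plane_simps)
qed

section \<open>Linear forms and their products\<close>

definition lin_form :: "'k::field \<Rightarrow> 'k \<Rightarrow> 'k \<Rightarrow> 'k poly poly" where
  "lin_form \<alpha> \<beta> \<gamma> = [:[:\<gamma>, \<alpha>:], [:\<beta>:]:]"

lemma leading_at_lin_form:
  assumes "leading_at g m n" "m + n = 1"
  obtains \<alpha> \<beta> \<gamma> where "g = lin_form \<alpha> \<beta> \<gamma>"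
proof
  have "coeff (coeff g i) k = 0" if "1 < k + i" for i k
    using assms that by (auto simp: leading_at_def)
  then have "coeff (coeff g i) k = coeff (coeff
      (lin_form (coeff (coeff g 0) 1) (coeff (coeff g 1) 0) (coeff (coeff g 0) 0)) i) k" for i k
    by (auto simp: lin_form_def coeff_pCons split: nat.splits)
  then show "g = lin_form (coeff (coeff g 0) 1) (coeff (coeff g 1) 0) (coeff (coeff g 0) 0)"
    by (intro poly_eqI)
qed

lemma lin_form_not_unit:
  assumes "q \<noteq> 0" "\<alpha> \<noteq> 0 \<or> \<beta> \<noteq> 0"
  shows "lin_form \<alpha> \<beta> \<gamma> \<notin> Units (quantum_plane q)"
  using assms by (auto simp: Units_quantum_plane lin_form_def qp_const_def)

text \<open>The only product that needs reordering is \<open>\<beta>y\<close> times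
  \<open>\<alpha>'x\<close>; it accounts for the single \<open>q\<close> in the coefficient of
  \<open>xy\<close>.\<close>

lemma lin_form_mult:
  "lin_form \<alpha> \<beta> \<gamma> \<otimes>\<^bsub>quantum_plane q\<^esub> lin_form \<alpha>' \<beta>' \<gamma>' =
   quad_form q (\<alpha> * \<alpha>') (\<alpha> * \<beta>' + q * \<beta> * \<alpha>') (\<beta> * \<beta>')
     (\<alpha> * \<gamma>' + \<gamma> * \<alpha>') (\<beta> * \<gamma>' + \<gamma> * \<beta>') (\<gamma> * \<gamma>')"
proof -
  let ?s = "\<lambda>p. p \<circ>\<^sub>p [:0, q:]"
  interpret ring_endo ?s by (rule ring_endo_scale)
  have "lin_form \<alpha> \<beta> \<gamma> = [:[:\<gamma>, \<alpha>:]:] + monom [:\<beta>:] 1"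
    by (simp add: lin_form_def monom_Suc monom_0)
  \<comment> \<open>Left multiplication by \<open>r y\<close> applies the endomorphism once to every
    coefficient and raises the \<open>y\<close>-degree by one.\<close>
  moreover have "skew_mult ?s (monom r 1) G = pCons 0 (smult r (map_poly ?s G))" for r G
  proof (rule poly_eqI)
    fix n
    have "coeff (skew_mult ?s (monom r 1) G) n =
        (\<Sum>i=0..n. if i = 1 then r * ?s (coeff G (n - 1)) else 0)"
      unfolding coeff_skew_mult by (rule sum.cong) auto
    then show "coeff (skew_mult ?s (monom r 1) G) n = coeff (pCons 0 (smult r (map_poly ?s G))) n"
      by (cases n) (simp_all add: coeff_map_poly)
  qed
  ultimately have "lin_form \<alpha> \<beta> \<gamma> \<otimes>\<^bsub>quantum_plane q\<^esub> lin_form \<alpha>' \<beta>' \<gamma>' =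
      smult [:\<gamma>, \<alpha>:] (lin_form \<alpha>' \<beta>' \<gamma>') +
      pCons 0 (smult [:\<beta>:] (map_poly ?s (lin_form \<alpha>' \<beta>' \<gamma>')))"
    by (simp add: quantum_plane_def skew_poly_ring_def skew_mult_add_left skew_mult_const)
  then show ?thesis
    by (simp add: lin_form_def quad_form_eq map_poly_pCons pcompose_pCons algebra_simps)
qed

lemma quad_form_inject:
  "quad_form q a b c d e f = quad_form q a' b' c' d' e' f' \<longleftrightarrow>
     a = a' \<and> b = b' \<and> c = c' \<and> d = d' \<and> e = e' \<and> f = f'"
  by (auto simp: quad_form_eq)

lemma coeff_quad_form_eq_0:
  "2 < m + n \<Longrightarrow> coeff (coeff (quad_form q a b c d e f) n) m = 0"
  by (auto simp: quad_form_eq coeff_pCons split: nat.splits)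

text \<open>This turns factorization in the quantum plane into six equations over the field,
  obtained by comparing coefficients in a product of two linear forms.\<close>

lemma nc_reducible_quad_form_iff:
  fixes q :: "'k::field"
  assumes q: "q \<noteq> 0" and abc: "a \<noteq> 0 \<or> b \<noteq> 0 \<or> c \<noteq> 0"
  shows "nc_reducible (quantum_plane q) (quad_form q a b c d e f) \<longleftrightarrow>
    (\<exists>\<alpha> \<beta> \<gamma> \<alpha>' \<beta>' \<gamma>'. a = \<alpha> * \<alpha>' \<and> b = \<alpha> * \<beta>' + q * \<beta> * \<alpha>' \<and> c = \<beta> * \<beta>' \<and>
       d = \<alpha> * \<gamma>' + \<gamma> * \<alpha>' \<and> e = \<beta> * \<gamma>' + \<gamma> * \<beta>' \<and> f = \<gamma> * \<gamma>')"
    (is "nc_reducible _ ?F \<longleftrightarrow> ?R")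
proof -
  interpret ring "quantum_plane q" by (rule ring_quantum_plane)
  have F0: "?F \<noteq> 0" and Fu: "?F \<notin> Units (quantum_plane q)"
    using abc by (auto simp: Units_quantum_plane[OF q] quad_form_eq qp_const_def)
  have "nc_reducible (quantum_plane q) ?F \<longleftrightarrow>
      (\<exists>g h. g \<notin> Units (quantum_plane q) \<and> h \<notin> Units (quantum_plane q) \<and>
         ?F = g \<otimes>\<^bsub>quantum_plane q\<^esub> h)"
    using F0 Fu by (auto simp: nc_reducible_def nc_irreducible_def quantum_plane_simps)
  also have "\<dots> \<longleftrightarrow> (\<exists>\<alpha> \<beta> \<gamma> \<alpha>' \<beta>' \<gamma>'.
      ?F = lin_form \<alpha> \<beta> \<gamma> \<otimes>\<^bsub>quantum_plane q\<^esub> lin_form \<alpha>' \<beta>' \<gamma>')"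
  proof (intro iffI; elim exE conjE)
    fix g h
    assume gu: "g \<notin> Units (quantum_plane q)" and hu: "h \<notin> Units (quantum_plane q)"
      and F: "?F = g \<otimes>\<^bsub>quantum_plane q\<^esub> h"
    have "g \<noteq> 0" "h \<noteq> 0"
      using F F0 l_null[of h] r_null[of g] by (auto simp: quantum_plane_simps)
    then obtain m n m' n' where g: "leading_at g m n" and h: "leading_at h m' n'"
      by (metis leading_at_exists)
    have "\<not> leading_at g 0 0" "\<not> leading_at h 0 0"
      using gu hu leading_at_0_0 unfolding Units_quantum_plane[OF q] by blast+
    then have "m + n \<noteq> 0" "m' + n' \<noteq> 0" using g h by (metis add_is_0)+
    \<comment> \<open>The product of the leading monomials occurs in the form, so its total degree
      is at most two; two nonconstant factors must then have degree one each.\<close>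
    moreover have "m + m' + (n + n') \<le> 2"
      using leading_at_mult_nonzero[OF q g h] coeff_quad_form_eq_0 by (metis F not_le)
    ultimately have "m + n = 1" "m' + n' = 1" by linarith+
    then obtain \<alpha> \<beta> \<gamma> \<alpha>' \<beta>' \<gamma>' where "g = lin_form \<alpha> \<beta> \<gamma>" "h = lin_form \<alpha>' \<beta>' \<gamma>'"
      by (metis g h leading_at_lin_form)
    then show "\<exists>\<alpha> \<beta> \<gamma> \<alpha>' \<beta>' \<gamma>'.
        ?F = lin_form \<alpha> \<beta> \<gamma> \<otimes>\<^bsub>quantum_plane q\<^esub> lin_form \<alpha>' \<beta>' \<gamma>'"
      using F by blast
  next
    fix \<alpha> \<beta> \<gamma> \<alpha>' \<beta>' \<gamma>'
    assume F: "?F = lin_form \<alpha> \<beta> \<gamma> \<otimes>\<^bsub>quantum_plane q\<^esub> lin_form \<alpha>' \<beta>' \<gamma>'"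
    \<comment> \<open>A constant factor would make all of \<open>a\<close>, \<open>b\<close>,
      \<open>c\<close> zero.\<close>
    then have "\<alpha> \<noteq> 0 \<or> \<beta> \<noteq> 0" "\<alpha>' \<noteq> 0 \<or> \<beta>' \<noteq> 0"
      using abc by (auto simp: lin_form_mult quad_form_inject)
    then show "\<exists>g h. g \<notin> Units (quantum_plane q) \<and> h \<notin> Units (quantum_plane q) \<and>
        ?F = g \<otimes>\<^bsub>quantum_plane q\<^esub> h"
      using F lin_form_not_unit[OF q] by metis
  qed
  also have "\<dots> \<longleftrightarrow> ?R" by (simp add: lin_form_mult quad_form_inject)
  finally show ?thesis .
qed

section \<open>The discriminant and the homogeneous part\<close>

lemma homogeneous_factors_imp_disc_square:
  "is_square (quantum_disc q (\<alpha> * \<alpha>') (\<alpha> * \<beta>' + q * \<beta> * \<alpha>') (\<beta> * \<beta>'))"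
proof -
  have "quantum_disc q (\<alpha> * \<alpha>') (\<alpha> * \<beta>' + q * \<beta> * \<alpha>') (\<beta> * \<beta>') = (\<alpha> * \<beta>' - q * \<beta> * \<alpha>')\<^sup>2"
    by (simp add: quantum_disc_def power2_eq_square algebra_simps)
  then show ?thesis by (auto simp: is_nth_power_def)
qed

text \<open>Solving \<open>s + qt = b\<close> and \<open>s - qt = \<delta>\<close> gives a matrix
  with rows \<open>(a, s)\<close> and \<open>(t, c)\<close> of determinant zero. It is the product
  of the column \<open>(\<alpha>, \<beta>)\<close> and the row \<open>(\<alpha>', \<beta>')\<close>,
  read off after normalizing by a nonzero diagonal entry.\<close>

lemma homogeneous_factors_exist:
  fixes q :: "'k::field"
  assumes two: "(2::'k) \<noteq> 0" and q: "q \<noteq> 0" and D: "quantum_disc q a b c = \<delta>\<^sup>2"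
  shows "\<exists>\<alpha> \<beta> \<alpha>' \<beta>'. a = \<alpha> * \<alpha>' \<and> b = \<alpha> * \<beta>' + q * \<beta> * \<alpha>' \<and> c = \<beta> * \<beta>'"
proof -
  define s t where "s = (b + \<delta>) / 2" and "t = (b - \<delta>) / (2 * q)"
  have four: "(4::'k) \<noteq> 0" using two mult_eq_0_iff[of "2::'k" 2] by simp
  have b: "b = s + q * t" using two four q by (simp add: s_def t_def field_simps)
  have d: "\<delta> = s - q * t" using two four q by (simp add: s_def t_def field_simps)
  have "(2 * 2 * q) * (s * t) = (2 * 2 * q) * (a * c)"
    using D unfolding b d quantum_disc_def by (simp add: power2_eq_square algebra_simps)
  then have st: "s * t = a * c" using four q by simp
  consider "a \<noteq> 0" | "c \<noteq> 0" | "a = 0" "c = 0" by blast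
  then show ?thesis
  proof cases
    case 1
    then show ?thesis using b st
      by (intro exI[of _ 1] exI[of _ "t / a"] exI[of _ a] exI[of _ s]) (simp add: field_simps)
  next
    case 2
    then show ?thesis using b st
      by (intro exI[of _ "s / c"] exI[of _ 1] exI[of _ t] exI[of _ c]) (simp add: field_simps)
  next
    \<comment> \<open>Only \<open>bxy\<close> remains, which is \<open>bx\<close> times
      \<open>y\<close>.\<close>
    case 3
    then show ?thesis
      by (intro exI[of _ b] exI[of _ 0] exI[of _ 0] exI[of _ 1]) simp
  qed
qed

section \<open>Reducibility of quadratic forms without linear terms\<close>

theorem theorem6:
  fixes q a b c f :: "'k::field"
  assumes "CHAR('k) \<noteq> 2"
    and "q \<noteq> 0"
    and "a \<noteq> 0 \<or> b \<noteq> 0 \<or> c \<noteq> 0"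
  shows "nc_reducible (quantum_plane q) (quad_form q a b c 0 0 f) \<longleftrightarrow>
      (f = 0 \<and> is_square (quantum_disc q a b c)) \<or>
      (f \<noteq> 0 \<and>
       (\<exists>\<delta>. quantum_disc q a b c = \<delta>\<^sup>2 \<and> \<delta> * (1 + q) = b * (q - 1)) \<and>
       ((a \<noteq> 0 \<and> is_square (- (a * f))) \<or> (c \<noteq> 0 \<and> is_square (- (c * f)))))"
    (is "_ \<longleftrightarrow> ?zero \<or> ?nonzero")
proof -
  have two: "(2::'k) \<noteq> 0"
  proof
    assume "(2::'k) = 0"
    then have "of_nat 2 = (0::'k)" by simp
    then have "CHAR('k) dvd 2" by (simp only: of_nat_eq_0_iff_char_dvd)
    then have "CHAR('k) = 1" using assms(1) two_is_prime_nat by (metis prime_nat_iff)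
    then show False by (simp add: CHAR_eqI)
  qed
  show ?thesis
    unfolding nc_reducible_quad_form_iff[OF assms(2,3)]
  proof
    assume "\<exists>\<alpha> \<beta> \<gamma> \<alpha>' \<beta>' \<gamma>'. a = \<alpha> * \<alpha>' \<and> b = \<alpha> * \<beta>' + q * \<beta> * \<alpha>' \<and> c = \<beta> * \<beta>' \<and>
       0 = \<alpha> * \<gamma>' + \<gamma> * \<alpha>' \<and> 0 = \<beta> * \<gamma>' + \<gamma> * \<beta>' \<and> f = \<gamma> * \<gamma>'"
    then obtain \<alpha> \<beta> \<gamma> \<alpha>' \<beta>' \<gamma>' where
      eqs: "a = \<alpha> * \<alpha>'" "b = \<alpha> * \<beta>' + q * \<beta> * \<alpha>'" "c = \<beta> * \<beta>'"
        "\<alpha> * \<gamma>' + \<gamma> * \<alpha>' = 0" "\<beta> * \<gamma>' + \<gamma> * \<beta>' = 0" "f = \<gamma> * \<gamma>'"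
      by metis
    show "?zero \<or> ?nonzero"
    proof (cases "f = 0")
      case True
      then show ?thesis using homogeneous_factors_imp_disc_square[of q \<alpha> \<alpha>' \<beta>' \<beta>] eqs(1-3) by simp
    next
      case False
      \<comment> \<open>This is the scalar \<lambda> of the overview: the vanishing linear
        coefficients make the second factor \<open>l\<close> times the first with the sign of
        \<gamma> reversed.\<close>
      define l where "l = - \<gamma>' / \<gamma>"
      have g: "\<gamma> \<noteq> 0" "\<gamma>' \<noteq> 0" using False eqs(6) by auto
      have p: "\<alpha>' = l * \<alpha>" "\<beta>' = l * \<beta>" "\<gamma>' = - l * \<gamma>"
        using eqs(4,5) g by (simp_all add: l_def field_simps add_eq_0_iff)
      have abcf: "a = l * \<alpha>\<^sup>2" "b = l * \<alpha> * \<beta> * (1 + q)" "c = l * \<beta>\<^sup>2" "f = - (l * \<gamma>\<^sup>2)"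
        unfolding eqs(1,2,3,6) p by (simp_all add: power2_eq_square algebra_simps)
      \<comment> \<open>As \<open>(1 + q)^2 - 4q = (q - 1)^2\<close>, a root is visible; the second
        condition on \<delta> dictates the choice of sign.\<close>
      have "quantum_disc q a b c = (l * \<alpha> * \<beta> * (q - 1))\<^sup>2"
        "l * \<alpha> * \<beta> * (q - 1) * (1 + q) = b * (q - 1)"
        unfolding abcf quantum_disc_def by (simp_all add: power2_eq_square algebra_simps)
      moreover have "- (a * f) = (l * \<alpha> * \<gamma>)\<^sup>2" "- (c * f) = (l * \<beta> * \<gamma>)\<^sup>2"
        unfolding abcf by (simp_all add: power2_eq_square algebra_simps)
      then have "is_square (- (a * f))" "is_square (- (c * f))"
        by (auto simp: is_nth_power_def)
      \<comment> \<open>If \<open>a\<close> and \<open>c\<close> were both zero, then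
        \<open>l * \<alpha> * \<beta>\<close>, and with it \<open>b\<close>, would be zero.\<close>
      moreover have "a \<noteq> 0 \<or> c \<noteq> 0" using assms(3) abcf(1-3) by auto
      ultimately show ?thesis using False by blast
    qed
  next
    assume "?zero \<or> ?nonzero"
    then show "\<exists>\<alpha> \<beta> \<gamma> \<alpha>' \<beta>' \<gamma>'. a = \<alpha> * \<alpha>' \<and> b = \<alpha> * \<beta>' + q * \<beta> * \<alpha>' \<and> c = \<beta> * \<beta>' \<and>
       0 = \<alpha> * \<gamma>' + \<gamma> * \<alpha>' \<and> 0 = \<beta> * \<gamma>' + \<gamma> * \<beta>' \<and> f = \<gamma> * \<gamma>'"
      (is ?R)
    proof
      assume z: ?zero
      then obtain \<delta> where "quantum_disc q a b c = \<delta>\<^sup>2" by (auto simp: is_nth_power_def)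
      from homogeneous_factors_exist[OF two assms(2) this] obtain \<alpha> \<beta> \<alpha>' \<beta>' where
        "a = \<alpha> * \<alpha>'" "b = \<alpha> * \<beta>' + q * \<beta> * \<alpha>'" "c = \<beta> * \<beta>'" by blast
      then show ?R using z
        by (intro exI[of _ \<alpha>] exI[of _ \<beta>] exI[of _ 0] exI[of _ \<alpha>'] exI[of _ \<beta>'] exI[of _ 0]) simp
    next
      assume nz: ?nonzero
      then obtain \<delta> where D: "quantum_disc q a b c = \<delta>\<^sup>2" and E: "\<delta> * (1 + q) = b * (q - 1)"
        by blast
      \<comment> \<open>\<open>u\<close> plays the role of \<open>l * \<alpha> * \<beta>\<close>
        above, the common value of \<open>s\<close> and \<open>t\<close>. The aim is
        \<open>b = u * (1 + q)\<close> and \<open>a * c = u^2\<close>.\<close>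
      define u where "u = (b - \<delta>) / 2"
      have "b + \<delta> = q * (b - \<delta>)" using E by (simp add: algebra_simps)
      moreover have d2: "b - \<delta> = 2 * u" using two by (simp add: u_def)
      ultimately have "b + \<delta> = 2 * (q * u)" by simp
      with d2 have "2 * b = 2 * (u * (1 + q))" by (simp add: algebra_simps)
      then have b: "b = u * (1 + q)" using two by simp
      have "4 * q * (a * c) = (b + \<delta>) * (b - \<delta>)"
        using D by (simp add: quantum_disc_def power2_eq_square algebra_simps)
      also have "\<dots> = 4 * q * u\<^sup>2"
        unfolding d2 \<open>b + \<delta> = 2 * (q * u)\<close> by (simp add: power2_eq_square)
      finally have "(2 * 2 * q) * (a * c) = (2 * 2 * q) * u\<^sup>2" by simp
      then have ac: "a * c = u\<^sup>2" 
        using two assms(2) by (metis mult_cancel_left no_zero_divisors)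
      from nz show ?R
      proof (elim conjE disjE)
        assume a: "a \<noteq> 0" and "is_square (- (a * f))"
        then obtain r where r: "- (a * f) = r\<^sup>2" by (auto simp: is_nth_power_def)
        \<comment> \<open>The factorization is \<open>x + (u/a)y + r/a\<close> times
          \<open>ax + uy - r\<close>. The equations are written in the shape of the goal so that
          \<open>blast\<close> can read off the witnesses.\<close>
        have "f = r / a * - r" "c = u / a * u"
          using a r ac by (simp_all add: nonzero_eq_divide_eq power2_eq_square mult.commute
              minus_equation_iff[of "a * f"])
        moreover have "b = 1 * u + q * (u / a) * a" "0 = 1 * - r + r / a * a"
          "0 = u / a * - r + r / a * u" "a = 1 * a"
          using a b by (simp_all add: distrib_left mult.commute)
        ultimately show ?R by blast
      next
        assume c: "c \<noteq> 0" and "is_square (- (c * f))"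
        then obtain r where r: "- (c * f) = r\<^sup>2" by (auto simp: is_nth_power_def)
        \<comment> \<open>Here it is \<open>(u/c)x + y + r/c\<close> times
          \<open>ux + cy - r\<close>.\<close>
        have "f = r / c * - r" "a = u / c * u"
          using c r ac by (simp_all add: nonzero_eq_divide_eq power2_eq_square mult.commute
              minus_equation_iff[of "c * f"])
        moreover have "b = u / c * c + q * 1 * u" "0 = u / c * - r + r / c * u"
          "0 = 1 * - r + r / c * c" "c = 1 * c"
          using c b by (simp_all add: distrib_left mult.commute)
        ultimately show ?R by blast
      qed
    qed
  qed
qed

end
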